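(* Any $n$-dimensional $2d$-th order conjugate partial-symmetric tensor $\mathcal{F}\in\mathbb{C}^{n^{2d}}$ uniquely defines, under the map $\mathbf{S}$, an $n$-dimensional $2d$-th degree real-valued symmetric conjugate form, and vice versa under $\mathbf{S}^{-1}$. That is, if $\mathcal{F}$ is conjugate partial-symmetric then $\mathbf{S}(\mathcal{F})$ is a real-valued symmetric conjugate form, and if $f_S$ is a real-valued symmetric conjugate form then $\mathbf{S}^{-1}(f_S)$ is conjugate partial-symmetric.
   Context: $\Pi(i_1\dots i_d)$ denotes the set of all distinct permutations of the indices $i_1,\dots,i_d$. A symmetric conjugate form of degree $2d$ in $\boldsymbol{x}\in\mathbb{C}^n$ is a function $$f_S(\boldsymbol{x})=\sum_{1\le i_1 \le \dots \le i_d \le n}\ \sum_{1\le j_1 \le \dots \le j_d \le n} a_{i_1\dots i_d,j_1\dots j_d}\,\overline{x_{i_1}\cdots x_{i_d}}\,x_{j_1} \cdots x_{j_d}$$ with complex coefficients. It is real-valued if $f_S(\boldsymbol{x})\in\mathbb{R}$ for all $\boldsymbol{x}\in\mathbb{C}^n$. A tensor $\mathcal{F}\in\mathbb{C}^{n^{2d}}$ is partial-symmetric if for all $1\le i_1\le\dots\le i_d\le n$ and $1\le i_{d+1}\le\dots\le i_{2d}\le n$, (i) $\mathcal{F}_{i_1\dots i_d i_{d+1}\dots i_{2d}} = \mathcal{F}_{j_1\dots j_d j_{d+1}\dots j_{2d}}$ for all $(j_1\dots j_d) \in \Pi (i_1\dots i_d)$ and $(j_{d+1}\dots j_{2d})\in\Pi(i_{d+1}\dots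 i_{2d})$. It is conjugate partial-symmetric if in addition, for all such indices, (ii) $\mathcal{F}_{i_1\dots i_d i_{d+1}\dots i_{2d}} = \overline{\mathcal{F}_{i_{d+1}\dots i_{2d} i_1\dots i_d}}$. The bijection $\mathbf{S}$ from partial-symmetric tensors in $\mathbb{C}^{n^{2d}}$ to symmetric conjugate forms of degree $2d$ in $\boldsymbol{x}\in\mathbb{C}^n$ is $$\mathbf{S}(\mathcal{F})(\boldsymbol{x})=\sum_{i_1=1}^n\cdots\sum_{i_{2d}=1}^n \mathcal{F}_{i_1\dots i_d i_{d+1}\dots i_{2d}}\,\overline{x_{i_1}\cdots x_{i_d}}\,x_{i_{d+1}} \cdots x_{i_{2d}},$$ and its inverse $\mathcal{F}=\mathbf{S}^{-1}(f_S)$ is given by $$\mathcal{F}_{j_1\dots j_d j_{d+1}\dots j_{2d}}=\frac{a_{i_1\dots i_d ,i_{d+1}\dots i_{2d}}} {|\Pi(i_1\dots i_d)| \cdot |\Pi(i_{d+1}\dots i_{2d})|}$$ for all $1\le i_1\le\dots\le i_d\le n$, $1\le i_{d+1}\le\dots\le i_{2d}\le n$, $(j_1\dots j_d) \in \Pi (i_1\dots i_d)$, $(j_{d+1}\dots j_{2d})\in\Pi(i_{d+1}\dots i_{2d})$. *)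

theory Defs
  imports "HOL-Analysis.Analysis" "HOL-Combinatorics.Multiset_Permutations"
begin

text \<open>
  The coordinates \<open>1, \<dots>, n\<close> are the elements of a finite linearly ordered type
  \<open>'n\<close>, so that \<open>n = CARD('n)\<close>; the index tuple
  \<open>i\<^sub>1 \<dots> i\<^sub>d\<close> is a list of length \<open>d\<close>.
  The set of its distinct permutations is \<open>permutations_of_multiset (mset i)\<close>.
\<close>

definition index_lists :: "nat \<Rightarrow> 'n list set" where
  "index_lists d = {i. length i = d}"

definition sorted_index_lists :: "nat \<Rightarrow> 'n::linorder list set" where
  "sorted_index_lists d = {i. length i = d \<and> sorted i}"

abbreviation index_perms :: "'n list \<Rightarrow> 'n list set" where
  "index_perms i \<equiv> permutations_of_multiset (mset i)"

definition monomial :: "complex ^ 'n \<Rightarrow> 'n list \<Rightarrow> complex" where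
  "monomial x i = (\<Prod>k\<leftarrow>i. x $ k)"

definition conj_form ::
  "nat \<Rightarrow> ('n list \<Rightarrow> 'n list \<Rightarrow> complex) \<Rightarrow> complex ^ 'n::{finite,linorder} \<Rightarrow> complex" where
  "conj_form d a x =
     (\<Sum>i\<in>sorted_index_lists d. \<Sum>j\<in>sorted_index_lists d.
        a i j * cnj (monomial x i) * monomial x j)"

definition symmetric_conjugate_form ::
  "nat \<Rightarrow> (complex ^ 'n::{finite,linorder} \<Rightarrow> complex) \<Rightarrow> bool" where
  "symmetric_conjugate_form d f \<longleftrightarrow> (\<exists>a. f = conj_form d a)"

definition real_valued :: "(complex ^ 'n \<Rightarrow> complex) \<Rightarrow> bool" where
  "real_valued f \<longleftrightarrow> (\<forall>x. f x \<in> \<real>)"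

text \<open>
  A tensor of order \<open>m\<close> takes the value \<open>undefined\<close> on lists of any length other
  than \<open>m\<close>, so that equality of tensors is equality of their entries.
\<close>

definition tensors :: "nat \<Rightarrow> ('n list \<Rightarrow> complex) set" where
  "tensors m = index_lists m \<rightarrow>\<^sub>E UNIV"

definition partial_symmetric :: "nat \<Rightarrow> ('n::{finite,linorder} list \<Rightarrow> complex) \<Rightarrow> bool" where
  "partial_symmetric d F \<longleftrightarrow>
     F \<in> tensors (2 * d) \<and>
     (\<forall>i\<in>sorted_index_lists d. \<forall>k\<in>sorted_index_lists d.
        \<forall>j\<in>index_perms i. \<forall>l\<in>index_perms k. F (i @ k) = F (j @ l))"

definition conj_partial_symmetric ::
  "nat \<Rightarrow> ('n::{finite,linorder} list \<Rightarrow> complex) \<Rightarrow> bool" where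
  "conj_partial_symmetric d F \<longleftrightarrow>
     partial_symmetric d F \<and>
     (\<forall>i\<in>sorted_index_lists d. \<forall>k\<in>sorted_index_lists d. F (i @ k) = cnj (F (k @ i)))"

definition form_of_tensor ::
  "nat \<Rightarrow> ('n list \<Rightarrow> complex) \<Rightarrow> complex ^ 'n::finite \<Rightarrow> complex" where
  "form_of_tensor d F x =
     (\<Sum>i\<in>index_lists d. \<Sum>j\<in>index_lists d.
        F (i @ j) * cnj (monomial x i) * monomial x j)"

text \<open>
  The monomials in \<open>cnj x\<close> and \<open>x\<close> are linearly independent functions, so a symmetric
  conjugate form determines its coefficients at sorted index lists. Other index lists do not
  occur in \<open>conj_form\<close>; the coefficients there are set to zero to make the family unique.
\<close>

definition form_coeffs ::
  "nat \<Rightarrow> (complex ^ 'n::{finite,linorder} \<Rightarrow> complex) \<Rightarrow> 'n list \<Rightarrow> 'n list \<Rightarrow> complex" where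
  "form_coeffs d f =
     (THE a. f = conj_form d a \<and>
        (\<forall>i j. i \<notin> sorted_index_lists d \<or> j \<notin> sorted_index_lists d \<longrightarrow> a i j = 0))"

text \<open>
  In the entry at \<open>l\<close>, the sorted lists \<open>i\<close> and \<open>k\<close> are the unique ones of which the two
  halves of \<open>l\<close> are permutations.
\<close>

definition tensor_of_form ::
  "nat \<Rightarrow> (complex ^ 'n::{finite,linorder} \<Rightarrow> complex) \<Rightarrow> 'n list \<Rightarrow> complex" where
  "tensor_of_form d f =
     (\<lambda>l\<in>index_lists (2 * d).
        let i = sort (take d l); k = sort (drop d l)
        in form_coeffs d f i k / of_nat (card (index_perms i) * card (index_perms k)))"

end

theory Submission
  imports Defs
begin

text \<open>
  The theorem compares a condition on tensor entries with a condition on values of a function, so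
  it rests on the fact that a form determines its coefficients: the functions
  \<open>x \<mapsto> cnj (monomial x i) * monomial x j\<close>, for sorted \<open>i\<close> and \<open>j\<close> of length \<open>d\<close>, are linearly
  independent. Each of them is multiplicative for the componentwise product of vectors and takes
  the value \<open>1\<close> at the all-ones vector, and distinct multiplicative functions into a field are
  linearly independent (Dedekind). It therefore suffices that they are pairwise distinct, and this
  is seen at vectors with a single coordinate different from \<open>1\<close>: there the function becomes
  \<open>cnj z ^ p * z ^ q\<close>, where \<open>p\<close> and \<open>q\<close> count the occurrences of that coordinate in \<open>i\<close> and
  \<open>j\<close>, and real \<open>z\<close> detects \<open>p + q\<close> while \<open>z\<close> on the unit circle detects \<open>q - p\<close>
  (\<open>conj_form_coeffs_unique\<close>).

  Conjugating a form replaces its coefficient matrix by the conjugate transpose. By uniqueness of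
  the coefficients, the form is real-valued if and only if this matrix is Hermitian
  (\<open>real_valued_conj_form_iff\<close>).

  For a partial-symmetric tensor, all index tuples with the same sorted halves \<open>i\<close> and \<open>k\<close>
  contribute the same summand, so the form of the tensor has the coefficient
  \<open>card (index_perms i) * card (index_perms k) * F (i @ k)\<close> at \<open>(i, k)\<close>
  (\<open>form_of_partial_symmetric_tensor\<close>). The inverse map divides by exactly these orbit sizes, which
  makes the two maps inverse to each other. Since the orbit factor is positive and symmetric in
  \<open>i\<close> and \<open>k\<close>, the coefficient matrix is Hermitian if and only if the tensor is conjugate
  partial-symmetric (\<open>real_valued_form_of_tensor_iff\<close>), and both directions of the theorem follow.
\<close>

section \<open>Linear independence of the monomials in a vector and its conjugate\<close>

text \<open>
  Dedekind's argument: subtracting \<open>\<phi> j y\<close> times a relation at \<open>x\<close> from the relation at \<open>y * x\<close>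
  removes the term of \<open>\<phi> j\<close> and multiplies every other coefficient by \<open>\<phi> i y - \<phi> j y\<close>, which is
  nonzero for a suitable \<open>y\<close>.
\<close>

lemma multiplicative_functions_independent:
  fixes \<phi> :: "'i \<Rightarrow> 'm::monoid_mult \<Rightarrow> 'a::field"
  assumes "finite I" and "inj_on \<phi> I"
    and one: "\<And>i. i \<in> I \<Longrightarrow> \<phi> i 1 = 1"
    and mult: "\<And>i x y. i \<in> I \<Longrightarrow> \<phi> i (x * y) = \<phi> i x * \<phi> i y"
    and "\<And>x. (\<Sum>i\<in>I. c i * \<phi> i x) = 0"
    and "i \<in> I"
  shows "c i = 0"
  using assms
proof (induction I arbitrary: c i rule: finite_induct)
  case empty
  then show ?case by simp
next
  case (insert j I)
  have sum0: "c j * \<phi> j x + (\<Sum>i\<in>I. c i * \<phi> i x) = 0" for x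
    using insert.prems(4)[of x] insert.hyps by simp
  have I0: "c k = 0" if k: "k \<in> I" for k
  proof -
    have "\<phi> k \<noteq> \<phi> j"
      using insert.prems(1) insert.hyps k by (metis inj_on_eq_iff insertI1 insertI2)
    then obtain y where y: "\<phi> k y \<noteq> \<phi> j y" by blast
    have "(\<Sum>i\<in>I. (c i * (\<phi> i y - \<phi> j y)) * \<phi> i x) = 0" for x
    proof -
      have "(\<Sum>i\<in>I. (c i * (\<phi> i y - \<phi> j y)) * \<phi> i x)
          = (\<Sum>i\<in>I. c i * \<phi> i (y * x)) - \<phi> j y * (\<Sum>i\<in>I. c i * \<phi> i x)"
        unfolding sum_distrib_left sum_subtractf[symmetric]
        by (rule sum.cong) (auto simp: insert.prems(3) algebra_simps)
      also have "\<dots> = (c j * \<phi> j (y * x) + (\<Sum>i\<in>I. c i * \<phi> i (y * x)))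
          - \<phi> j y * (c j * \<phi> j x + (\<Sum>i\<in>I. c i * \<phi> i x))"
        by (simp add: insert.prems(3) algebra_simps)
      finally show ?thesis by (simp add: sum0)
    qed
    then have "c k * (\<phi> k y - \<phi> j y) = 0"
      using insert.IH[of "\<lambda>i. c i * (\<phi> i y - \<phi> j y)" k] insert.prems(1-3) k
      by (auto simp: inj_on_insert)
    with y show ?thesis by simp
  qed
  have "c j = 0"
    using sum0[of 1] I0 insert.prems(2)[of j] by simp
  with I0 insert.prems(5) show ?case by auto
qed

definition hermitian_monomial :: "'n list \<times> 'n list \<Rightarrow> complex ^ 'n \<Rightarrow> complex" where
  "hermitian_monomial p x = cnj (monomial x (fst p)) * monomial x (snd p)"

lemma monomial_one: "monomial 1 i = 1"
  by (induction i) (simp_all add: monomial_def one_vec_def)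

lemma monomial_mult: "monomial (x * y) i = monomial x i * monomial y i"
  by (induction i) (simp_all add: monomial_def times_vec_def)

lemma monomial_axis:
  "monomial (\<chi> l. if l = k then z else 1) i = z ^ count (mset i) k"
  by (induction i) (simp_all add: monomial_def)

text \<open>
  The modulus of \<open>cnj z ^ p * z ^ q\<close> depends on \<open>p + q\<close> and its argument on \<open>q - p\<close>; the point \<open>2\<close>
  and one well-chosen point of the unit circle read these off.
\<close>

lemma cnj_powers_determine_exponents:
  assumes "\<And>z :: complex. cnj z ^ p * z ^ q = cnj z ^ p' * z ^ q'"
  shows "p = p' \<and> q = q'"
proof -
  have "(2::complex) ^ (p + q) = 2 ^ (p' + q')"
    using assms[of 2] by (simp add: power_add)
  then have "(2::nat) ^ (p + q) = 2 ^ (p' + q')"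
    by (metis of_nat_eq_iff of_nat_numeral of_nat_power)
  then have sum: "p + q = p' + q'" by simp
  define m where "m = (real q - real p) - (real q' - real p')"
  have cis: "cnj (cis t) ^ a * cis t ^ b = cis (t * (real b - real a))" for t a b
    by (simp add: cis_cnj Complex.DeMoivre cis_mult algebra_simps)
  have "m = 0"
  proof (rule ccontr)
    assume "m \<noteq> 0"
    \<comment> \<open>At angle \<open>pi / m\<close> the two sides have arguments that differ by exactly \<open>pi\<close>.\<close>
    define t where "t = pi / m"
    have "cis (t * (real q - real p)) = cis (t * (real q' - real p'))"
      using assms[of "cis t"] by (simp only: cis)
    then have "cis (t * (real q - real p)) * cis (- (t * (real q' - real p'))) = 1"
      by (simp add: cis_mult)
    moreover have "t * (real q - real p) + - (t * (real q' - real p')) = t * m"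
      unfolding m_def by (simp add: algebra_simps)
    moreover have "t * m = pi"
      using \<open>m \<noteq> 0\<close> unfolding t_def by simp
    ultimately have "cis pi = 1"
      unfolding cis_mult by simp
    then show False by simp
  qed
  with sum show ?thesis unfolding m_def by linarith
qed

lemma inj_on_hermitian_monomial:
  "inj_on (hermitian_monomial :: _ \<Rightarrow> complex ^ 'n::{finite,linorder} \<Rightarrow> _)
    (sorted_index_lists d \<times> sorted_index_lists d)"
proof (rule inj_onI, clarify)
  fix i j i' j' :: "'n list"
  assume sorted: "i \<in> sorted_index_lists d" "j \<in> sorted_index_lists d"
      "i' \<in> sorted_index_lists d" "j' \<in> sorted_index_lists d"
    and eq: "(hermitian_monomial (i, j) :: complex ^ 'n::{finite,linorder} \<Rightarrow> _) = hermitian_monomial (i', j')"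
  have "count (mset i) k = count (mset i') k \<and> count (mset j) k = count (mset j') k" for k
    using fun_cong[OF eq, of "\<chi> l. if l = k then _ else 1"]
    by (intro cnj_powers_determine_exponents) (simp add: hermitian_monomial_def monomial_axis)
  then have "mset i = mset i'" "mset j = mset j'"
    by (auto intro: multiset_eqI)
  then show "i = i' \<and> j = j'"
    using sorted by (metis (lifting) mem_Collect_eq properties_for_sort sorted_index_lists_def)
qed

lemma finite_index_lists: "finite (index_lists d :: 'n::finite list set)"
  unfolding index_lists_def using finite_lists_length_eq[of "UNIV :: 'n set" d] by simp

lemma finite_sorted_index_lists:
  "finite (sorted_index_lists d :: 'n::{finite,linorder} list set)"
  by (rule finite_subset[OF _ finite_index_lists[of d]])
    (auto simp: sorted_index_lists_def index_lists_def)

lemma conj_form_conv_hermitian_monomial: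
  "conj_form d a x = (\<Sum>p\<in>sorted_index_lists d \<times> sorted_index_lists d.
     a (fst p) (snd p) * hermitian_monomial p x)"
  by (simp add: conj_form_def hermitian_monomial_def sum.cartesian_product case_prod_beta mult.assoc)

lemma conj_form_coeffs_unique:
  fixes a b :: "'n::{finite,linorder} list \<Rightarrow> 'n list \<Rightarrow> complex"
  assumes "conj_form d a = conj_form d b"
    and "i \<in> sorted_index_lists d" and "j \<in> sorted_index_lists d"
  shows "a i j = b i j"
proof -
  let ?I = "sorted_index_lists d \<times> sorted_index_lists d :: ('n list \<times> 'n list) set"
  let ?c = "\<lambda>p. a (fst p) (snd p) - b (fst p) (snd p)"
  have "(\<Sum>p\<in>?I. ?c p * hermitian_monomial p x) = 0" for x
    using fun_cong[OF assms(1), of x]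
    by (simp add: conj_form_conv_hermitian_monomial sum_subtractf left_diff_distrib)
  then have "?c (i, j) = 0"
    using assms(2,3)
    by (intro multiplicative_functions_independent[of ?I hermitian_monomial ?c "(i, j)"])
      (auto simp: finite_sorted_index_lists inj_on_hermitian_monomial hermitian_monomial_def
        monomial_one monomial_mult)
  then show ?thesis by simp
qed

lemma conj_form_cong:
  assumes "\<And>i j. i \<in> sorted_index_lists d \<Longrightarrow> j \<in> sorted_index_lists d \<Longrightarrow> a i j = b i j"
  shows "conj_form d a = conj_form d b"
  unfolding conj_form_def using assms by (intro ext sum.cong) auto

lemma form_coeffs_conj_form:
  assumes "i \<in> sorted_index_lists d" and "j \<in> sorted_index_lists d"
  shows "form_coeffs d (conj_form d a) i j = a i j"
proof -
  let ?a = "\<lambda>i j. if i \<in> sorted_index_lists d \<and> j \<in> sorted_index_lists d then a i j else 0"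
  have "form_coeffs d (conj_form d a) = ?a"
    unfolding form_coeffs_def
  proof (rule the_equality)
    show "conj_form d a = conj_form d ?a \<and>
      (\<forall>i j. i \<notin> sorted_index_lists d \<or> j \<notin> sorted_index_lists d \<longrightarrow> ?a i j = 0)"
      by (auto intro!: conj_form_cong)
  next
    fix b
    assume b: "conj_form d a = conj_form d b \<and>
      (\<forall>i j. i \<notin> sorted_index_lists d \<or> j \<notin> sorted_index_lists d \<longrightarrow> b i j = 0)"
    then show "b = ?a"
      using conj_form_coeffs_unique[of d a b] by (intro ext) auto
  qed
  with assms show ?thesis by simp
qed

lemma cnj_conj_form: "cnj (conj_form d a x) = conj_form d (\<lambda>i j. cnj (a j i)) x"
  unfolding conj_form_def
  by (subst sum.swap) (simp add: cnj_sum mult_ac)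

text \<open>
  A function is real-valued when it equals its conjugate, and two forms are equal only if their
  coefficients are.
\<close>

lemma real_valued_conj_form_iff:
  "real_valued (conj_form d a) \<longleftrightarrow>
    (\<forall>i\<in>sorted_index_lists d. \<forall>j\<in>sorted_index_lists d. a i j = cnj (a j i))"
proof -
  have "real_valued (conj_form d a) \<longleftrightarrow> conj_form d a = conj_form d (\<lambda>i j. cnj (a j i))"
    unfolding real_valued_def fun_eq_iff cnj_conj_form[symmetric] Reals_cnj_iff by metis
  also have "\<dots> \<longleftrightarrow>
      (\<forall>i\<in>sorted_index_lists d. \<forall>j\<in>sorted_index_lists d. a i j = cnj (a j i))"
  proof
    assume "conj_form d a = conj_form d (\<lambda>i j. cnj (a j i))"
    then show "\<forall>i\<in>sorted_index_lists d. \<forall>j\<in>sorted_index_lists d. a i j = cnj (a j i)"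
      by (blast dest: conj_form_coeffs_unique)
  next
    assume "\<forall>i\<in>sorted_index_lists d. \<forall>j\<in>sorted_index_lists d. a i j = cnj (a j i)"
    then show "conj_form d a = conj_form d (\<lambda>i j. cnj (a j i))"
      by (intro conj_form_cong) blast
  qed
  finally show ?thesis .
qed

section \<open>Grouping index tuples by their sorted rearrangement\<close>

lemma sort_mem_sorted_index_lists: "length i = d \<Longrightarrow> sort i \<in> sorted_index_lists d"
  by (simp add: sorted_index_lists_def)

lemma mem_index_perms_sort: "i \<in> index_perms (sort i)"
  by (simp add: permutations_of_multiset_def)

lemma monomial_perm: "j \<in> index_perms i \<Longrightarrow> monomial x j = monomial x i"
  by (simp add: monomial_def permutations_of_multiset_def prod_mset_prod_list[symmetric])

lemma card_index_perms_nonzero: "card (index_perms i) \<noteq> 0"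
  by simp

text \<open>
  The fibre of \<open>sort\<close> over a sorted list is the set of its permutations, so the permutation orbits
  partition the index tuples.
\<close>

lemma sum_index_lists_by_sorted:
  fixes g :: "'n::{finite,linorder} list \<Rightarrow> 'a::comm_monoid_add"
  shows "(\<Sum>i\<in>index_lists d. g i) = (\<Sum>i\<in>sorted_index_lists d. \<Sum>j\<in>index_perms i. g j)"
proof -
  have orbit: "{j \<in> index_lists d. sort j = i} = index_perms i"
    if "i \<in> sorted_index_lists d" for i :: "'n list"
  proof -
    have "length i = d" "sorted i"
      using that by (simp_all add: sorted_index_lists_def)
    then have "length j = d \<and> sort j = i \<longleftrightarrow> mset j = mset i" for j
      by (metis mset_eq_length mset_sort properties_for_sort sorted_sort)
    then show ?thesis
      by (simp add: index_lists_def permutations_of_multiset_def)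
  qed
  have "(\<Sum>i\<in>index_lists d. g i)
      = (\<Sum>i\<in>sorted_index_lists d. \<Sum>j | j \<in> index_lists d \<and> sort j = i. g j)"
    by (rule sum.group[symmetric])
      (auto simp: index_lists_def sort_mem_sorted_index_lists
        finite_index_lists[unfolded index_lists_def] finite_sorted_index_lists)
  also have "\<dots> = (\<Sum>i\<in>sorted_index_lists d. \<Sum>j\<in>index_perms i. g j)"
    by (intro sum.cong refl orbit)
  finally show ?thesis .
qed

section \<open>The correspondence between tensors and forms\<close>

lemma partial_symmetric_sort:
  assumes "partial_symmetric d F" and "length i = d" and "length k = d"
  shows "F (i @ k) = F (sort i @ sort k)"
  using assms sort_mem_sorted_index_lists[of i d] sort_mem_sorted_index_lists[of k d]
    mem_index_perms_sort[of i] mem_index_perms_sort[of k]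
  unfolding partial_symmetric_def by fastforce

text \<open>
  Both the tensor entry and the monomials are constant on each permutation orbit, so an orbit
  contributes its size times the summand at its sorted representative.
\<close>

lemma form_of_partial_symmetric_tensor:
  fixes F :: "'n::{finite,linorder} list \<Rightarrow> complex"
  assumes "partial_symmetric d F"
  shows "form_of_tensor d F =
    conj_form d (\<lambda>i k. of_nat (card (index_perms i) * card (index_perms k)) * F (i @ k))"
proof
  fix x
  have "form_of_tensor d F x =
      (\<Sum>i\<in>sorted_index_lists d. \<Sum>j\<in>index_perms i. \<Sum>k\<in>sorted_index_lists d. \<Sum>l\<in>index_perms k.
        F (j @ l) * cnj (monomial x j) * monomial x l)"
    unfolding form_of_tensor_def sum_index_lists_by_sorted ..
  also have "\<dots> =
      (\<Sum>i\<in>sorted_index_lists d. \<Sum>j\<in>index_perms i. \<Sum>k\<in>sorted_index_lists d. \<Sum>l\<in>index_perms k.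
        F (i @ k) * cnj (monomial x i) * monomial x k)"
  proof (intro sum.cong refl)
    fix i j k l :: "'n list"
    assume *: "i \<in> sorted_index_lists d" "j \<in> index_perms i" "k \<in> sorted_index_lists d"
      "l \<in> index_perms k"
    then have "F (j @ l) = F (i @ k)"
      using assms unfolding partial_symmetric_def by metis
    with * show "F (j @ l) * cnj (monomial x j) * monomial x l
        = F (i @ k) * cnj (monomial x i) * monomial x k"
      by (simp add: monomial_perm)
  qed
  also have "\<dots> =
      conj_form d (\<lambda>i k. of_nat (card (index_perms i) * card (index_perms k)) * F (i @ k)) x"
    by (simp add: conj_form_def sum_distrib_left mult_ac)
  finally show "form_of_tensor d F x = \<dots>" .
qed

lemma tensor_of_conj_form:
  assumes "length j = d" and "length l = d"
  shows "tensor_of_form d (conj_form d a) (j @ l) =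
    a (sort j) (sort l) / of_nat (card (index_perms j) * card (index_perms l))"
  using assms
  by (simp add: tensor_of_form_def index_lists_def Let_def form_coeffs_conj_form
      sort_mem_sorted_index_lists)

lemma partial_symmetric_tensor_of_conj_form:
  fixes a :: "'n::{finite,linorder} list \<Rightarrow> 'n list \<Rightarrow> complex"
  shows "partial_symmetric d (tensor_of_form d (conj_form d a))"
  unfolding partial_symmetric_def
proof (intro conjI ballI)
  show "tensor_of_form d (conj_form d a) \<in> tensors (2 * d)"
    unfolding tensors_def tensor_of_form_def by (rule restrict_PiE_iff[THEN iffD2]) simp
next
  fix i j k l :: "'n list"
  assume *: "i \<in> sorted_index_lists d" "j \<in> index_perms i" "k \<in> sorted_index_lists d"
    "l \<in> index_perms k"
  then have m: "mset j = mset i" "mset l = mset k"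
    by (simp_all add: permutations_of_multiset_def)
  then have "sort j = sort i" "sort l = sort k"
    by (metis mset_sort properties_for_sort sorted_sort)+
  moreover have "length i = d" "length k = d" "length j = d" "length l = d"
    using * m by (auto simp: sorted_index_lists_def dest: mset_eq_length)
  ultimately show "tensor_of_form d (conj_form d a) (i @ k)
      = tensor_of_form d (conj_form d a) (j @ l)"
    by (simp add: tensor_of_conj_form m)
qed

lemma form_of_tensor_of_conj_form:
  "form_of_tensor d (tensor_of_form d (conj_form d a)) = conj_form d a"
  unfolding form_of_partial_symmetric_tensor[OF partial_symmetric_tensor_of_conj_form]
  by (rule conj_form_cong)
    (auto simp: sorted_index_lists_def tensor_of_conj_form sorted_sort_id card_index_perms_nonzero)

lemma tensor_of_form_of_tensor:
  assumes F: "partial_symmetric d F"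
  shows "tensor_of_form d (form_of_tensor d F) = F"
proof
  fix m
  show "tensor_of_form d (form_of_tensor d F) m = F m"
  proof (cases "length m = 2 * d")
    case True
    define j l where "j = take d m" and "l = drop d m"
    have m: "m = j @ l" "length j = d" "length l = d"
      using True by (simp_all add: j_def l_def)
    have "tensor_of_form d (form_of_tensor d F) (j @ l) = F (sort j @ sort l)"
      using m card_index_perms_nonzero[of j] card_index_perms_nonzero[of l]
      by (simp add: form_of_partial_symmetric_tensor[OF F] tensor_of_conj_form)
    also have "\<dots> = F (j @ l)"
      by (rule partial_symmetric_sort[OF F m(2,3), symmetric])
    finally show ?thesis unfolding m(1) .
  next
    case False
    then show ?thesis
      using F by (auto simp: partial_symmetric_def tensors_def tensor_of_form_def index_lists_def
          PiE_def extensional_def)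
  qed
qed

text \<open>
  The orbit factor \<open>card (index_perms i) * card (index_perms k)\<close> is real, nonzero and symmetric in
  \<open>i\<close> and \<open>k\<close>, so it cancels from the condition that the coefficient matrix is Hermitian.
\<close>

lemma real_valued_form_of_tensor_iff:
  assumes F: "partial_symmetric d F"
  shows "real_valued (form_of_tensor d F) \<longleftrightarrow> conj_partial_symmetric d F"
  unfolding form_of_partial_symmetric_tensor[OF F] real_valued_conj_form_iff
    conj_partial_symmetric_def
  using F by (simp add: mult.commute card_index_perms_nonzero)

theorem proposition3p8:
  fixes d :: nat
  shows "(\<forall>F :: 'n::{finite,linorder} list \<Rightarrow> complex.
            conj_partial_symmetric d F \<longrightarrow>
              symmetric_conjugate_form d (form_of_tensor d F) \<and>
              real_valued (form_of_tensor d F) \<and>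
              tensor_of_form d (form_of_tensor d F) = F) \<and>
         (\<forall>f :: complex ^ 'n::{finite,linorder} \<Rightarrow> complex.
            symmetric_conjugate_form d f \<and> real_valued f \<longrightarrow>
              conj_partial_symmetric d (tensor_of_form d f) \<and>
              form_of_tensor d (tensor_of_form d f) = f)"
proof (intro conjI allI impI; (elim conjE)?)
  fix F :: "'n list \<Rightarrow> complex"
  assume conj: "conj_partial_symmetric d F"
  then have F: "partial_symmetric d F"
    unfolding conj_partial_symmetric_def by (rule conjunct1)
  show "real_valued (form_of_tensor d F)"
    using conj real_valued_form_of_tensor_iff[OF F] by blast
  show "symmetric_conjugate_form d (form_of_tensor d F)"
    unfolding symmetric_conjugate_form_def using form_of_partial_symmetric_tensor[OF F] by blast
  show "tensor_of_form d (form_of_tensor d F) = F"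
    using F by (rule tensor_of_form_of_tensor)
next
  fix f :: "complex ^ 'n::{finite,linorder} \<Rightarrow> complex"
  assume "symmetric_conjugate_form d f" and real: "real_valued f"
  then obtain a where f: "f = conj_form d a"
    unfolding symmetric_conjugate_form_def by blast
  show eq: "form_of_tensor d (tensor_of_form d f) = f"
    unfolding f by (rule form_of_tensor_of_conj_form)
  show "conj_partial_symmetric d (tensor_of_form d f)"
    using real_valued_form_of_tensor_iff[OF partial_symmetric_tensor_of_conj_form[of d a]] eq real
    unfolding f by simp
qed

end
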